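(* Let $N\ge 1$ be an integer and let $\Gamma(N)$ be the set of sublattices (subgroups) of $\mathbb{Z}^2$ of index $N$, with $SL(2,\mathbb{Z})$ acting on $\Gamma(N)$ by its natural linear action on $\mathbb{Z}^2$. Then the number $\hat f(N)$ of orbits of $SL(2,\mathbb{Z})$ in $\Gamma(N)$ is $$\hat f(N)=\sum_{ab^2=N}1,$$ where the sum runs over all pairs $(a,b)$ of positive integers with $ab^2=N$.
   Context: Every sublattice of index $N$ of $\mathbb{Z}^2$ is generated by the rows of a unique matrix $B=\begin{pmatrix} k & 0\\ i & k'\end{pmatrix}$ with $k,k'$ positive integers, $kk'=N$, and $0\le i<k$ (Hermite normal form); this sublattice is denoted $\Gamma_{N;k,i}$. Multiplying $B$ on the left by $A\in SL(2,\mathbb{Z})$ gives another basis of the same lattice. The action of $A\in SL(2,\mathbb{Z})$ on $\Gamma(N)$ is given by multiplication on the right, $B\mapsto BA$: it sends the lattice generated by the rows of $B$ to the lattice generated by the rows of $BA$ (the image of the lattice under $v\mapsto vA$ on row vectors). *)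

theory Defs
  imports "HOL-Analysis.Determinants" "HOL-Algebra.Group_Action"
begin

definition Z2 :: "(int ^ 2) monoid"
  where "Z2 = \<lparr>carrier = UNIV, monoid.mult = (+), one = 0\<rparr>"

definition SL2Z :: "(int ^ 2 ^ 2) monoid"
  where "SL2Z = \<lparr>carrier = {A. det A = 1}, monoid.mult = (**), one = mat 1\<rparr>"

(* Cosets are counted by card, which is 0 for infinite sets: for N >= 1 the condition
   says that the index is finite and equal to N. *)
definition sublattices :: "nat \<Rightarrow> (int ^ 2) set set"
  where "sublattices N = {L. subgroup L Z2 \<and> card (rcosets\<^bsub>Z2\<^esub> L) = N}"

(* Elements of Z2 are row vectors, so this is a right action of SL2Z. The library
   constants orbit and orbits only use the carrier of the group and apply unchanged. *)
definition lattice_act :: "int ^ 2 ^ 2 \<Rightarrow> (int ^ 2) set \<Rightarrow> (int ^ 2) set"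
  where "lattice_act A L = (\<lambda>v. v v* A) ` L"

definition orbit_count :: "nat \<Rightarrow> nat"
  where "orbit_count N = card (orbits SL2Z (sublattices N) lattice_act)"

lemma group_Z2: "group Z2"
  unfolding Z2_def by (rule groupI) (auto simp: add.assoc intro: exI[of _ "- _"] left_minus)

lemma SL2Z_left_inverse:
  fixes A :: "int ^ 2 ^ 2"
  assumes "det A = 1"
  shows "\<exists>B. det B = 1 \<and> B ** A = mat 1"
proof -
  define B :: "int ^ 2 ^ 2"
    where "B = vector [vector [A$2$2, - A$1$2], vector [- A$2$1, A$1$1]]"
  have "det B = 1" "B ** A = mat 1"
    using assms
    by (simp_all add: B_def det_2 vec_eq_iff forall_2 matrix_matrix_mult_def mat_def sum_2 algebra_simps)
  then show ?thesis by blast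
qed

lemma group_SL2Z: "group SL2Z"
  unfolding SL2Z_def
  by (rule groupI) (auto simp: det_mul matrix_mul_assoc SL2Z_left_inverse)

lemma lattice_act_one: "lattice_act \<one>\<^bsub>SL2Z\<^esub> L = L"
  by (simp add: lattice_act_def SL2Z_def)

lemma lattice_act_mult: "lattice_act (A \<otimes>\<^bsub>SL2Z\<^esub> B) L = lattice_act B (lattice_act A L)"
  by (simp add: lattice_act_def SL2Z_def image_image vector_matrix_mul_assoc)

end

theory Submission
  imports Defs
begin

text \<open>
  Among the first coordinates of vectors in lattices of the orbit of \<open>L\<close>, let \<open>b\<close> be the smallest
  positive one. Minimality, applied through shears and the quarter turn, forces the orbit to contain
  \<open>b\<int> \<times> m\<int>\<close> with \<open>b\<close> dividing \<open>m\<close>. Its index is \<open>b m = a b\<^sup>2\<close> where \<open>m = a b\<close>, and \<open>b\<close> is an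
  invariant of the orbit, being the largest integer that divides every coordinate of every vector.
\<close>

definition box :: "int \<Rightarrow> int \<Rightarrow> (int ^ 2) set"
  where "box b m = {v. b dvd v$1 \<and> m dvd v$2}"

lemma mem_box: "v \<in> box b m \<longleftrightarrow> b dvd v$1 \<and> m dvd v$2"
  by (simp add: box_def)

lemma vector_matrix_mult_2:
  fixes A :: "int ^ 2 ^ 2"
  shows "(v v* A) $ j = v$1 * A$1$j + v$2 * A$2$j"
  by (simp add: vector_matrix_mult_def sum_2 mult.commute)

lemma inv_Z2: "inv\<^bsub>Z2\<^esub> x = - x"
  by (rule group.inv_equality[OF group_Z2]) (auto simp: Z2_def)

lemma subgroup_Z2_iff:
  "subgroup L Z2 \<longleftrightarrow> 0 \<in> L \<and> (\<forall>x\<in>L. \<forall>y\<in>L. x + y \<in> L) \<and> (\<forall>x\<in>L. - x \<in> L)"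
  unfolding subgroup_def inv_Z2 by (auto simp: Z2_def)

lemma subgroup_Z2_scale:
  assumes "subgroup L Z2" "v \<in> L"
  shows "k *s v \<in> L"
proof (induction k rule: int_induct[where k = 0])
  case base
  then show ?case using assms by (simp add: subgroup_Z2_iff)
next
  case (step1 i)
  have "(i + 1) *s v = i *s v + v"
    by (simp add: vec_eq_iff algebra_simps)
  then show ?case using assms step1 by (simp add: subgroup_Z2_iff)
next
  case (step2 i)
  have "(i - 1) *s v = i *s v + - v"
    by (simp add: vec_eq_iff algebra_simps)
  then show ?case using assms step2 unfolding subgroup_Z2_iff by metis
qed

lemma rcosets_Z2: "rcosets\<^bsub>Z2\<^esub> L = range (\<lambda>a. (\<lambda>h. h + a) ` L)"
  by (auto simp: RCOSETS_def r_coset_def Z2_def)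

lemma lattice_act_compose: "lattice_act B (lattice_act A L) = lattice_act (A ** B) L"
  by (simp add: lattice_act_def image_image vector_matrix_mul_assoc)

lemma lattice_act_mat_1 [simp]: "lattice_act (mat 1) L = L"
  by (simp add: lattice_act_def)

lemma SL2Z_inverse:
  fixes A :: "int ^ 2 ^ 2"
  assumes "det A = 1"
  obtains B where "det B = 1" "A ** B = mat 1" "B ** A = mat 1"
proof -
  interpret group SL2Z by (rule group_SL2Z)
  have A: "A \<in> carrier SL2Z" using assms by (simp add: SL2Z_def)
  show thesis
    by (rule that[of "inv\<^bsub>SL2Z\<^esub> A"])
      (use inv_closed[OF A] r_inv[OF A] l_inv[OF A] in \<open>simp_all add: SL2Z_def\<close>)
qed

lemma inj_vector_matrix_mult_SL2Z:
  fixes A :: "int ^ 2 ^ 2"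
  assumes "det A = 1"
  shows "inj (\<lambda>v. v v* A)"
proof -
  obtain B where B: "A ** B = mat 1" using SL2Z_inverse[OF assms] .
  have "(v v* A) v* B = v" for v
    by (simp add: vector_matrix_mul_assoc B)
  then show ?thesis by (rule inj_on_inverseI)
qed

lemma vector_matrix_add: "(u + v) v* A = u v* A + v v* (A :: int ^ 2 ^ 2)"
  by (simp add: vec_eq_iff vector_matrix_mult_2 algebra_simps)

lemma subgroup_lattice_act:
  assumes "subgroup L Z2"
  shows "subgroup (lattice_act A L) Z2"
proof -
  have lin: "0 v* A = 0" "- (x v* A) = - x v* A" for x
    by (simp_all add: vec_eq_iff vector_matrix_mult_2)
  have L: "0 \<in> L" "\<And>x y. x \<in> L \<Longrightarrow> y \<in> L \<Longrightarrow> x + y \<in> L" "\<And>x. x \<in> L \<Longrightarrow> - x \<in> L"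
    using assms by (auto simp: subgroup_Z2_iff)
  have "0 \<in> (\<lambda>v. v v* A) ` L"
    using imageI[OF L(1), of "\<lambda>v. v v* A"] by (simp add: lin(1))
  then show ?thesis
    unfolding subgroup_Z2_iff lattice_act_def ball_simps vector_matrix_add[symmetric] lin(2)
    by (intro conjI ballI imageI L)
qed

lemma card_rcosets_lattice_act:
  assumes "det A = 1"
  shows "card (rcosets\<^bsub>Z2\<^esub> (lattice_act A L)) = card (rcosets\<^bsub>Z2\<^esub> L)"
proof -
  obtain B where B: "B ** A = mat 1" using SL2Z_inverse[OF assms] .
  have "(a v* B) v* A = a" for a
    by (simp add: vector_matrix_mul_assoc B)
  then have surj: "range (\<lambda>a. a v* A) = UNIV"
    by (metis surjI)
  have "rcosets\<^bsub>Z2\<^esub> (lattice_act A L) = (\<lambda>a. (\<lambda>h. h + a) ` lattice_act A L) ` range (\<lambda>a. a v* A)"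
    unfolding rcosets_Z2 surj ..
  also have "\<dots> = lattice_act A ` (rcosets\<^bsub>Z2\<^esub> L)"
    by (simp add: rcosets_Z2 lattice_act_def image_image vector_matrix_add)
  finally have eq: "rcosets\<^bsub>Z2\<^esub> (lattice_act A L) = lattice_act A ` (rcosets\<^bsub>Z2\<^esub> L)" .
  have "inj (lattice_act A)"
    unfolding lattice_act_def using inj_vector_matrix_mult_SL2Z[OF assms]
    by (simp add: inj_image_eq_iff inj_on_def)
  then show ?thesis
    unfolding eq by (intro card_image) (auto intro: inj_on_subset)
qed

lemma sublattices_lattice_act:
  assumes "det A = 1" "L \<in> sublattices N"
  shows "lattice_act A L \<in> sublattices N"
  using assms by (simp add: sublattices_def subgroup_lattice_act card_rcosets_lattice_act)

lemma orbit_SL2Z: "orbit SL2Z lattice_act L = {lattice_act A L | A. det A = 1}"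
  by (simp add: orbit_def SL2Z_def)

lemma orbit_lattice_act:
  assumes "det A = 1"
  shows "orbit SL2Z lattice_act (lattice_act A L) = orbit SL2Z lattice_act L"
proof -
  have sub: "orbit SL2Z lattice_act (lattice_act A L) \<subseteq> orbit SL2Z lattice_act L"
    if "det A = 1" for A L
  proof
    fix M assume "M \<in> orbit SL2Z lattice_act (lattice_act A L)"
    then obtain B where "det B = 1" "M = lattice_act (A ** B) L"
      unfolding orbit_SL2Z lattice_act_compose by blast
    moreover from this have "det (A ** B) = 1" using that by (simp add: det_mul)
    ultimately show "M \<in> orbit SL2Z lattice_act L" unfolding orbit_SL2Z by blast
  qed
  obtain B where B: "det B = 1" "A ** B = mat 1" using SL2Z_inverse[OF assms] .
  have "lattice_act B (lattice_act A L) = L"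
    by (simp add: lattice_act_compose B)
  with sub[OF assms, of L] sub[OF B(1), of "lattice_act A L"] show ?thesis by simp
qed

lemma subgroup_box: "subgroup (box b m) Z2"
  by (auto simp: subgroup_Z2_iff mem_box)

lemma rcoset_box_eq_iff:
  "(\<lambda>h. h + u) ` box b m = (\<lambda>h. h + v) ` box b m \<longleftrightarrow> u - v \<in> box b m"
proof
  assume eq: "(\<lambda>h. h + u) ` box b m = (\<lambda>h. h + v) ` box b m"
  have "u \<in> (\<lambda>h. h + u) ` box b m" by (auto simp: mem_box image_iff)
  then show "u - v \<in> box b m" unfolding eq by auto
next
  assume d: "u - v \<in> box b m"
  have "(\<lambda>h. h + u) ` box b m \<subseteq> (\<lambda>h. h + v) ` box b m" if "u - v \<in> box b m" for u v
  proof
    fix x assume "x \<in> (\<lambda>h. h + u) ` box b m"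
    then have "x - u \<in> box b m" by auto
    then have "(x - u) + (u - v) \<in> box b m"
      using that subgroup_box[of b m] unfolding subgroup_Z2_iff by blast
    then have "x - v \<in> box b m" by simp
    then show "x \<in> (\<lambda>h. h + v) ` box b m" by (auto intro: image_eqI[of _ _ "x - v"])
  qed
  moreover have "v - u \<in> box b m"
    using d subgroup_box[of b m] unfolding subgroup_Z2_iff by (metis minus_diff_eq)
  ultimately show "(\<lambda>h. h + u) ` box b m = (\<lambda>h. h + v) ` box b m" using d by blast
qed

lemma card_rcosets_box:
  assumes "b > 0" "m > 0"
  shows "card (rcosets\<^bsub>Z2\<^esub> (box b m)) = nat (b * m)"
proof -
  let ?C = "\<lambda>a. (\<lambda>h. h + a) ` box b m"
  let ?v = "\<lambda>(x, y). vector [x, y] :: int ^ 2"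
  let ?S = "{0..<b} \<times> {0..<m}"
  have residue: "x = y" if "x \<in> {0..<c}" "y \<in> {0..<c}" "c dvd x - y" for x y c :: int
    using that by (metis atLeastLessThan_iff mod_eq_dvd_iff mod_pos_pos_trivial)
  have "inj_on (?C \<circ> ?v) ?S"
    by (rule inj_onI) (auto simp: rcoset_box_eq_iff mem_box intro: residue)
  moreover have "(?C \<circ> ?v) ` ?S = rcosets\<^bsub>Z2\<^esub> (box b m)"
  proof -
    have "?C a \<in> (?C \<circ> ?v) ` ?S" for a
    proof (rule image_eqI)
      show "?C a = (?C \<circ> ?v) (a$1 mod b, a$2 mod m)"
        by (simp add: rcoset_box_eq_iff mem_box)
      show "(a$1 mod b, a$2 mod m) \<in> ?S" using assms by simp
    qed
    then show ?thesis unfolding rcosets_Z2 by auto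
  qed
  ultimately have "card (rcosets\<^bsub>Z2\<^esub> (box b m)) = card ?S"
    by (metis card_image)
  then show ?thesis using assms by (simp add: card_cartesian_product nat_mult_distrib)
qed

lemma infinite_rcosets_box_0: "infinite (rcosets\<^bsub>Z2\<^esub> (box b 0))"
proof
  assume "finite (rcosets\<^bsub>Z2\<^esub> (box b 0))"
  moreover have "range (\<lambda>k. (\<lambda>h. h + vector [0, k]) ` box b 0) \<subseteq> rcosets\<^bsub>Z2\<^esub> (box b 0)"
    unfolding rcosets_Z2 by blast
  ultimately have "finite (range (\<lambda>k :: int. (\<lambda>h. h + vector [0, k]) ` box b 0))"
    by (rule rev_finite_subset)
  moreover have "inj (\<lambda>k :: int. (\<lambda>h. h + vector [0, k]) ` box b 0)"
    by (rule injI) (simp add: rcoset_box_eq_iff mem_box)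
  ultimately show False by (simp add: finite_image_iff)
qed

lemma shear_act:
  obtains A :: "int ^ 2 ^ 2" where "det A = 1" "\<And>v. v v* A = vector [v$1, v$2 + t * v$1]"
  by (rule that[of "vector [vector [1, t], vector [0, 1]]"])
    (simp_all add: det_2 vec_eq_iff forall_2 vector_matrix_mult_2)

lemma quarter_turn_act:
  obtains A :: "int ^ 2 ^ 2" where "det A = 1" "\<And>v. v v* A = vector [v$2, - v$1]"
  by (rule that[of "vector [vector [0, - 1], vector [1, 0]]"])
    (simp_all add: det_2 vec_eq_iff forall_2 vector_matrix_mult_2)

lemma dvd_of_no_smaller_residue:
  fixes b :: int
  assumes "b > 0" "\<not> (0 < x mod b \<and> x mod b < b)"
  shows "b dvd x"
  using assms by (metis dvd_eq_mod_eq_0 order_less_le pos_mod_bound pos_mod_sign)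

lemma int_subgroup_principal:
  fixes H :: "int set"
  assumes "0 \<in> H" "\<And>x y. x \<in> H \<Longrightarrow> y \<in> H \<Longrightarrow> x + y \<in> H" "\<And>k x. x \<in> H \<Longrightarrow> k * x \<in> H"
  shows "\<exists>m\<ge>0. H = {x. m dvd x}"
proof (intro exI conjI)
  have "Gcd H \<in> H"
  proof (cases "H \<subseteq> {0}")
    case True
    then have "H = {0}" using assms(1) by blast
    then show ?thesis by simp
  next
    case False
    then obtain h where "h \<in> H" "h \<noteq> 0" by auto
    then have ex: "int (nat \<bar>h\<bar>) \<in> H \<and> nat \<bar>h\<bar> > 0"
      using assms(3)[of h "sgn h"] by (auto simp: sgn_if split: if_splits)
    define c where "c = (LEAST n. int n \<in> H \<and> n > 0)"
    have c: "int c \<in> H" "c > 0"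
      using LeastI[of "\<lambda>n. int n \<in> H \<and> n > 0", OF ex] unfolding c_def by auto
    have "int c dvd x" if "x \<in> H" for x
    proof (rule dvd_of_no_smaller_residue)
      have "x + (- (x div int c)) * int c \<in> H" using assms c that by blast
      then have "int (nat (x mod int c)) \<in> H"
        using c by (simp add: minus_div_mult_eq_mod)
      then show "\<not> (0 < x mod int c \<and> x mod int c < int c)"
        unfolding c_def using not_less_Least[of "nat (x mod int c)" "\<lambda>n. int n \<in> H \<and> n > 0"]
        by (auto simp: nat_less_iff simp flip: c_def)
    qed (use c in simp)
    then have "Gcd H = int c"
      using c by (intro Gcd_eqI) auto
    then show ?thesis using c by simp
  qed
  then show "H = {x. Gcd H dvd x}"
    using assms(3) by (auto elim!: dvdE simp: mult.commute)
qed simp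

lemma orbit_contains_box:
  assumes "subgroup L Z2"
  obtains A b m where "det A = 1" "b \<ge> 0" "m \<ge> 0" "b dvd m" "lattice_act A L = box b m"
proof -
  define P where "P n \<longleftrightarrow> n > 0 \<and> (\<exists>A v. det A = 1 \<and> v \<in> lattice_act A L \<and> v$1 = int n)" for n
  have P_I: "P (nat (v$1))" if "det A = 1" "v \<in> lattice_act A L" "v$1 > 0" for A v
    using that unfolding P_def by auto
  have act: "v v* B \<in> lattice_act (A ** B) L" if "v \<in> lattice_act A L" for v A B
    using that unfolding lattice_act_compose[symmetric] lattice_act_def[of B] by blast
  show thesis
  proof (cases "\<exists>n. P n")
    case False
    have zero: "v$1 = 0" if A: "det A = 1" and v: "v \<in> lattice_act A L" for A v
    proof -
      have "- v \<in> lattice_act A L"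
        using subgroup_lattice_act[OF assms, of A] v unfolding subgroup_Z2_iff by blast
      with P_I[OF A v] P_I[OF A, of "- v"] False show ?thesis by force
    qed
    obtain R :: "int ^ 2 ^ 2" where R: "det R = 1" "\<And>v. v v* R = vector [v$2, - v$1]"
      by (rule quarter_turn_act) (rule that)
    have "v$1 = 0 \<and> v$2 = 0" if "v \<in> L" for v
      using zero[of "mat 1" v] zero[of "mat 1 ** R" "v v* R"] act[of v "mat 1" R] R that by simp
    moreover have "v \<in> L" if "v$1 = 0" "v$2 = 0" for v
    proof -
      have "v = 0" using that by (simp add: vec_eq_iff forall_2)
      then show ?thesis using assms by (simp add: subgroup_Z2_iff)
    qed
    ultimately have "L = box 0 0" by (auto simp: mem_box)
    then show thesis using that[of "mat 1" 0 0] by simp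
  next
    case True
    define n where "n = (LEAST n. P n)"
    define b where "b = int n"
    have "P n" unfolding n_def using True by (rule LeastI_ex)
    then obtain A v where A: "det A = 1" "v \<in> lattice_act A L" "v$1 = b" and b: "b > 0"
      unfolding P_def b_def by auto
    have minimal: "\<not> (0 < w$1 \<and> w$1 < b)" if "det B = 1" "w \<in> lattice_act B L" for B w
      using not_less_Least[of "nat (w$1)" P] P_I[OF that] unfolding b_def n_def by linarith
    have dvd2: "b dvd w$2" if B: "det B = 1" and w: "w \<in> lattice_act B L" "w$1 = b" for B w
    proof (rule dvd_of_no_smaller_residue[OF b])
      obtain T :: "int ^ 2 ^ 2"
        where T: "det T = 1" "\<And>v. v v* T = vector [v$1, v$2 + (- (w$2 div b)) * v$1]"
        by (rule shear_act) (rule that)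
      obtain R :: "int ^ 2 ^ 2" where R: "det R = 1" "\<And>v. v v* R = vector [v$2, - v$1]"
        by (rule quarter_turn_act) (rule that)
      have entry: "(w v* T v* R)$1 = w$2 mod b"
        by (simp add: T R w minus_div_mult_eq_mod)
      have "det (B ** T ** R) = 1" using B T R by (simp add: det_mul)
      from minimal[OF this act[OF act[OF w(1)]]] show "\<not> (0 < w$2 mod b \<and> w$2 mod b < b)"
        unfolding entry .
    qed
    obtain T :: "int ^ 2 ^ 2"
      where T: "det T = 1" "\<And>u. u v* T = vector [u$1, u$2 + (- (v$2 div b)) * u$1]"
      by (rule shear_act) (rule that)
    define M where "M = lattice_act (A ** T) L"
    have det: "det (A ** T) = 1" using A T by (simp add: det_mul)
    have M: "subgroup M Z2" unfolding M_def by (rule subgroup_lattice_act[OF assms])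
    have add: "x + y \<in> M" if "x \<in> M" "y \<in> M" for x y
      using M that unfolding subgroup_Z2_iff by blast
    have "v v* T = vector [b, 0]"
      using dvd2[OF A] by (simp add: T A vec_eq_iff forall_2)
    then have e: "vector [b, 0] \<in> M" using act[OF A(2), of T] by (simp add: M_def)
    have "k *s vector [b, 0] = (vector [k * b, 0] :: int ^ 2)" for k
      by (simp add: vec_eq_iff forall_2)
    then have ke: "vector [k * b, 0] \<in> M" for k
      using subgroup_Z2_scale[OF M e, of k] by simp
    have dvd1: "b dvd w$1" if "w \<in> M" for w
    proof (rule dvd_of_no_smaller_residue[OF b])
      have entry: "(w + vector [(- (w$1 div b)) * b, 0])$1 = w$1 mod b"
        by (simp add: minus_div_mult_eq_mod)
      have "w + vector [(- (w$1 div b)) * b, 0] \<in> lattice_act (A ** T) L"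
        using add[OF that ke] unfolding M_def .
      from minimal[OF det this] show "\<not> (0 < w$1 mod b \<and> w$1 mod b < b)"
        unfolding entry .
    qed
    define H where "H = {y. vector [0, y] \<in> M}"
    have H_0: "0 \<in> H" using ke[of 0] by (simp add: H_def)
    have H_add: "x + y \<in> H" if "x \<in> H" "y \<in> H" for x y
    proof -
      have "vector [0, x] + vector [0, y] = (vector [0, x + y] :: int ^ 2)"
        by (simp add: vec_eq_iff forall_2)
      then show ?thesis using that add[of "vector [0, x]" "vector [0, y]"] by (simp add: H_def)
    qed
    have H_scale: "k * x \<in> H" if "x \<in> H" for k x
    proof -
      have "k *s vector [0, x] = (vector [0, k * x] :: int ^ 2)"
        by (simp add: vec_eq_iff forall_2)
      then show ?thesis
        using that subgroup_Z2_scale[OF M, of "vector [0, x]" k] by (simp add: H_def)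
    qed
    have "\<exists>m\<ge>0. H = {x. m dvd x}"
      by (rule int_subgroup_principal) (simp_all add: H_0 H_add H_scale)
    then obtain m where m: "m \<ge> 0" and H: "H = {x. m dvd x}" by blast
    have M_iff: "vector [0, y] \<in> M \<longleftrightarrow> m dvd y" for y
      using arg_cong[OF H, of "\<lambda>S. y \<in> S"] by (simp add: H_def)
    then have "vector [0, m] \<in> M" by simp
    then have "vector [0, m] + vector [b, 0] \<in> M" using e by (rule add)
    then have "b dvd m" using dvd2[OF det, of "vector [0, m] + vector [b, 0]"] by (simp add: M_def)
    moreover have "w \<in> M \<longleftrightarrow> w \<in> box b m" for w
    proof -
      show ?thesis
      proof (cases "b dvd w$1")
        case True
        then obtain k where k: "w$1 = k * b" by (metis dvdE mult.commute)
        have "vector [0, w$2] + vector [k * b, 0] = w" "w + vector [(- k) * b, 0] = vector [0, w$2]"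
          by (simp_all add: vec_eq_iff forall_2 k)
        then have "w \<in> M \<longleftrightarrow> vector [0, w$2] \<in> M"
          using add[OF _ ke, of w "- k"] add[OF _ ke, of "vector [0, w$2]" k] by auto
        with M_iff True show ?thesis by (simp add: mem_box)
      next
        case False
        then show ?thesis using dvd1 by (auto simp: mem_box)
      qed
    qed
    ultimately show thesis
      using that[OF det, of b m] b m by (auto simp: M_def)
  qed
qed

lemma lattice_act_box_dvd:
  assumes "b dvd m" "lattice_act A (box b m) = box b' m'"
  shows "b dvd b'"
proof -
  have "vector [b', 0] \<in> lattice_act A (box b m)" using assms by (simp add: mem_box)
  then obtain v where v: "v \<in> box b m" "vector [b', 0] = v v* A"
    unfolding lattice_act_def by blast
  have "b dvd (v v* A)$1"
    using v(1) assms(1) by (auto simp: mem_box vector_matrix_mult_2 intro: dvd_trans)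
  then show ?thesis by (simp flip: v(2))
qed

theorem mainTheorem1:
  fixes N :: nat
  assumes "N \<ge> 1"
  shows "orbit_count N = (\<Sum>(a, b) \<in> {(a, b). a > 0 \<and> b > 0 \<and> a * b ^ 2 = N}. 1)"
proof -
  let ?S = "{(a, b). a > 0 \<and> b > 0 \<and> a * b ^ 2 = N}"
  let ?orb = "orbit SL2Z lattice_act"
  define F where "F = (\<lambda>(a, b). ?orb (box (int b) (int (a * b))))"
  have "inj_on F ?S"
  proof (rule inj_onI)
    fix p q assume p: "p \<in> ?S" and q: "q \<in> ?S" and eq: "F p = F q"
    obtain a b where ab: "p = (a, b)" by fastforce
    obtain a' b' where ab': "q = (a', b')" by fastforce
    have dvd: "b dvd b'" if eq: "?orb (box (int b) (int (a * b))) = ?orb (box (int b') (int (a' * b')))"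
      for a b a' b'
    proof -
      have "box (int b') (int (a' * b')) \<in> ?orb (box (int b) (int (a * b)))"
        unfolding eq unfolding orbit_SL2Z by (auto intro!: exI[of _ "mat 1"])
      then obtain A where act: "box (int b') (int (a' * b')) = lattice_act A (box (int b) (int (a * b)))"
        unfolding orbit_SL2Z by blast
      show ?thesis using lattice_act_box_dvd[OF _ act[symmetric]] by simp
    qed
    have eq': "?orb (box (int b) (int (a * b))) = ?orb (box (int b') (int (a' * b')))"
      using eq by (simp add: F_def ab ab')
    have "b = b'"
      using dvd[OF eq'] dvd[OF eq'[symmetric]] by (rule dvd_antisym)
    then show "p = q" using p q by (auto simp: ab ab')
  qed
  moreover have "F ` ?S = orbits SL2Z (sublattices N) lattice_act"
  proof (intro equalityI subsetI)
    fix X assume "X \<in> F ` ?S"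
    then obtain a b where ab: "a > 0" "b > 0" "a * b ^ 2 = N"
      and X: "X = ?orb (box (int b) (int (a * b)))"
      by (auto simp: F_def)
    have "nat (int b * int (a * b)) = N"
      using ab by (simp add: nat_mult_distrib power2_eq_square ac_simps)
    then have "box (int b) (int (a * b)) \<in> sublattices N"
      using ab by (simp add: sublattices_def subgroup_box card_rcosets_box)
    then show "X \<in> orbits SL2Z (sublattices N) lattice_act"
      unfolding X orbits_def by blast
  next
    fix X assume "X \<in> orbits SL2Z (sublattices N) lattice_act"
    then obtain L where L: "L \<in> sublattices N" and X: "X = ?orb L"
      unfolding orbits_def by blast
    obtain A b m where A: "det A = 1" and bm: "b \<ge> 0" "m \<ge> 0" "b dvd m"
      and box: "lattice_act A L = box b m"
      using orbit_contains_box[of L] L by (auto simp: sublattices_def)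
    have card: "card (rcosets\<^bsub>Z2\<^esub> (box b m)) = N"
      using sublattices_lattice_act[OF A L] by (simp add: box sublattices_def)
    have "m \<noteq> 0" using card assms infinite_rcosets_box_0[of b] by auto
    with bm have pos: "b > 0" "m > 0" by (auto simp: order_less_le)
    obtain a where a: "m = b * a" using bm(3) by (rule dvdE)
    have a_pos: "a > 0" using pos a by (simp add: zero_less_mult_iff)
    have "nat a * nat b ^ 2 = N"
      using card card_rcosets_box[OF pos] pos a_pos
      by (simp add: a nat_mult_distrib power2_eq_square ac_simps)
    moreover have "X = F (nat a, nat b)"
      using orbit_lattice_act[OF A, of L] pos a_pos by (simp add: X F_def box a mult.commute)
    ultimately show "X \<in> F ` ?S" using pos a_pos by auto
  qed
  ultimately have "orbit_count N = card ?S"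
    unfolding orbit_count_def using card_image[of F ?S] by simp
  then show ?thesis by (simp add: split_def)
qed

end
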